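(* Let $0<\nu<\infty$, $0\leq\alpha<d$ and $1<p\leq q<\infty$ with $\frac1q+\frac{\alpha}{d}=\frac1p$, and let $\mathcal{S}$ be a sparse collection of dyadic cubes in $\mathbb{R}^d$. For any weight $w$, $$\|\mathcal{A}_{\alpha,\nu}^{\mathcal{S}}\|_{L^{p}(w^{p})\rightarrow L^{q,\infty}(w^{q})}\geq[w]_{A_{p,q}}^{\frac{1}{q}},$$ where $[w]_{A_{p,q}}$ is the characteristic with supremum over the cubes $Q\in\mathcal{S}$.
   Context: A weight on $\mathbb{R}^d$ is a locally integrable function $w:\mathbb{R}^d\to(0,\infty)$; $L^p(w^p)$ and $L^{q,\infty}(w^q)$ are taken with respect to the measures $w^p\,dx$ and $w^q\,dx$. Dyadic cubes are those of a fixed dyadic grid on $\mathbb{R}^d$. A collection $\mathcal{S}$ of dyadic cubes is sparse (with parameter $0<\gamma<1$) if for each $Q\in\mathcal{S}$ there is $E_Q\subset Q$ with $|E_Q|\geq\gamma|Q|$, the sets $E_Q$, $Q\in\mathcal S$, being pairwise disjoint. For nonnegative $f$ set $$\langle f\rangle_{\alpha,Q}=\frac{1}{|Q|^{1-\alpha/d}}\int_Q f,\qquad \mathcal{A}_{\alpha,\nu}^{\mathcal{S}}(f)=\Big(\sum_{Q\in\mathcal{S}}\langle f\rangle_{\alpha,Q}^{\nu}\mathbf{1}_Q\Big)^{1/\nu}.$$ The norm $\|\mathcal{A}_{\alpha,\nu}^{\mathcal{S}}\|_{L^{p}(w^{p})\rightarrow L^{q,\infty}(w^{q})}$ is the least $C\in[0,\infty]$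 with $\|\mathcal{A}_{\alpha,\nu}^{\mathcal{S}}(f)\|_{L^{q,\infty}(w^q)}\le C\|f\|_{L^p(w^p)}$ for all nonnegative $f\in L^p(w^p)$, where $\|g\|_{L^{q,\infty}(u)}=\sup_{\lambda>0}\lambda\,u(\{|g|>\lambda\})^{1/q}$. With $1/p+1/p'=1$, the (sparse version of the) characteristic is $$[w]_{A_{p,q}}=\sup_{Q\in\mathcal{S}}\Big(\frac{1}{|Q|}\int_Q w^q\Big)\Big(\frac{1}{|Q|}\int_Q w^{-p'}\Big)^{q/p'}.$$ *)

theory Defs
  imports "HOL-Analysis.Analysis"
begin

section \<open>Powers of extended nonnegative reals\<close>

text \<open>Only used with exponents \<open>r > 0\<close>; then \<open>0\<close> is sent to \<open>0\<close> and \<open>\<infinity>\<close> to \<open>\<infinity>\<close>.\<close>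

definition powr_ennreal :: "ennreal \<Rightarrow> real \<Rightarrow> ennreal" (infixr \<open>powr\<^sub>e\<close> 80) where
  "x powr\<^sub>e r = (if x = \<infinity> then \<infinity> else ennreal (enn2real x powr r))"


section \<open>Dyadic grids and sparse collections\<close>

definition cube :: "real ^ 'n \<Rightarrow> real \<Rightarrow> (real ^ 'n) set" where
  "cube a l = {x. \<forall>i. a $ i \<le> x $ i \<and> x $ i < a $ i + l}"

definition dyadic_grid :: "(real ^ 'n) set set \<Rightarrow> bool" where
  "dyadic_grid \<D> \<longleftrightarrow>
     (\<forall>Q\<in>\<D>. \<exists>a. \<exists>k::int. Q = cube a (2 powi k)) \<and>
     (\<forall>k::int. partition_on UNIV {Q \<in> \<D>. \<exists>a. Q = cube a (2 powi k)}) \<and>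
     (\<forall>Q\<in>\<D>. \<forall>R\<in>\<D>. Q \<inter> R \<in> {Q, R, {}})"

definition sparse_collection :: "real \<Rightarrow> (real ^ 'n::finite) set set \<Rightarrow> bool" where
  "sparse_collection \<gamma> \<S> \<longleftrightarrow> 0 < \<gamma> \<and> \<gamma> < 1 \<and>
     (\<exists>E. (\<forall>Q\<in>\<S>. E Q \<subseteq> Q \<and> E Q \<in> sets lebesgue \<and>
                   measure lebesgue (E Q) \<ge> \<gamma> * measure lebesgue Q) \<and>
          disjoint_family_on E \<S>)"


section \<open>Weights and weighted spaces\<close>

definition weight :: "(real ^ 'n::finite \<Rightarrow> real) \<Rightarrow> bool" where
  "weight w \<longleftrightarrow> (\<forall>x. w x > 0) \<and> (\<forall>K. compact K \<longrightarrow> w absolutely_integrable_on K)"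

definition weighted :: "(real ^ 'n::finite \<Rightarrow> real) \<Rightarrow> real \<Rightarrow> (real ^ 'n) measure" where
  "weighted w r = density lebesgue (\<lambda>x. ennreal (w x powr r))"

definition Lp_norm :: "real \<Rightarrow> 'a measure \<Rightarrow> ('a \<Rightarrow> real) \<Rightarrow> ennreal" where
  "Lp_norm p M f = (\<integral>\<^sup>+x. ennreal (\<bar>f x\<bar> powr p) \<partial>M) powr\<^sub>e (1 / p)"

definition Lp_space :: "real \<Rightarrow> 'a measure \<Rightarrow> ('a \<Rightarrow> real) set" where
  "Lp_space p M = {f \<in> borel_measurable M. Lp_norm p M f < \<infinity>}"

definition weak_Lq_norm :: "real \<Rightarrow> 'a measure \<Rightarrow> ('a \<Rightarrow> ennreal) \<Rightarrow> ennreal" where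
  "weak_Lq_norm q M g =
     (SUP l\<in>{0<..}. ennreal l * emeasure M {x \<in> space M. g x > ennreal l} powr\<^sub>e (1 / q))"


section \<open>The sparse operator, its norm, and the characteristic\<close>

definition frac_avg :: "real \<Rightarrow> (real ^ 'n::finite) set \<Rightarrow> (real ^ 'n \<Rightarrow> real) \<Rightarrow> ennreal" where
  "frac_avg \<alpha> Q f =
     (\<integral>\<^sup>+x\<in>Q. ennreal (f x) \<partial>lebesgue) / emeasure lebesgue Q powr\<^sub>e (1 - \<alpha> / real CARD('n))"

definition sparse_op ::
  "real \<Rightarrow> real \<Rightarrow> (real ^ 'n::finite) set set \<Rightarrow> (real ^ 'n \<Rightarrow> real) \<Rightarrow> real ^ 'n \<Rightarrow> ennreal" where
  "sparse_op \<alpha> \<nu> \<S> f x =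
     (\<Sum>\<^sub>\<infinity>Q\<in>\<S>. frac_avg \<alpha> Q f powr\<^sub>e \<nu> * indicator Q x) powr\<^sub>e (1 / \<nu>)"

text \<open>The infimum is \<open>\<infinity>\<close> if no constant is admissible.\<close>

definition sparse_op_norm ::
  "real \<Rightarrow> real \<Rightarrow> (real ^ 'n::finite) set set \<Rightarrow> real \<Rightarrow> real \<Rightarrow> (real ^ 'n \<Rightarrow> real) \<Rightarrow> ennreal" where
  "sparse_op_norm \<alpha> \<nu> \<S> p q w =
     Inf {C. \<forall>f \<in> Lp_space p (weighted w p). (\<forall>x. 0 \<le> f x) \<longrightarrow>
            weak_Lq_norm q (weighted w q) (sparse_op \<alpha> \<nu> \<S> f)
              \<le> C * Lp_norm p (weighted w p) f}"

definition conj_exp :: "real \<Rightarrow> real" where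
  "conj_exp p = p / (p - 1)"

lemma conj_exp: "1 < p \<Longrightarrow> 1 / p + 1 / conj_exp p = 1"
  by (simp add: conj_exp_def field_simps)

definition avg :: "(real ^ 'n::finite) set \<Rightarrow> (real ^ 'n \<Rightarrow> real) \<Rightarrow> ennreal" where
  "avg Q g = (\<integral>\<^sup>+x\<in>Q. ennreal (g x) \<partial>lebesgue) / emeasure lebesgue Q"

definition Apq_char ::
  "(real ^ 'n::finite) set set \<Rightarrow> real \<Rightarrow> real \<Rightarrow> (real ^ 'n \<Rightarrow> real) \<Rightarrow> ennreal" where
  "Apq_char \<S> p q w =
     (SUP Q\<in>\<S>. avg Q (\<lambda>x. w x powr q) *
                avg Q (\<lambda>x. w x powr (- conj_exp p)) powr\<^sub>e (q / conj_exp p))"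


section \<open>The standard dyadic grid\<close>

definition standard_cube :: "int \<Rightarrow> ('n \<Rightarrow> int) \<Rightarrow> (real ^ 'n::finite) set" where
  "standard_cube k m = cube (\<chi> i. 2 powi k * of_int (m i)) (2 powi k)"

lemma in_standard_cube: "x \<in> standard_cube k m \<longleftrightarrow> (\<forall>i. \<lfloor>x $ i / 2 powi k\<rfloor> = m i)"
proof -
  have p: "(0::real) < 2 powi k" by simp
  have "(2 powi k * of_int (m i) \<le> x $ i \<and> x $ i < 2 powi k * of_int (m i) + 2 powi k)
        \<longleftrightarrow> \<lfloor>x $ i / 2 powi k\<rfloor> = m i" for i
    using p by (simp add: floor_eq_iff pos_le_divide_eq pos_divide_less_eq algebra_simps)
  then show ?thesis by (simp add: standard_cube_def cube_def)
qed

lemma cube_side_unique: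
  fixes a b :: "real ^ 'n::finite"
  assumes eq: "cube a l = cube b r" and l: "0 < l" and r: "0 < r"
  shows "a = b \<and> l = r"
proof -
  have *: "b $ i \<le> a $ i \<and> a $ i + l \<le> b $ i + r"
    if "cube a l \<subseteq> cube b r" "0 < l" for a b :: "real ^ 'n" and l r i
  proof
    have "a \<in> cube a l" using that(2) by (simp add: cube_def)
    then show "b $ i \<le> a $ i" using that(1) by (auto simp: cube_def)
    show "a $ i + l \<le> b $ i + r"
    proof (rule field_le_epsilon)
      fix e :: real assume "0 < e"
      define t where "t = max 0 (l - e)"
      have t: "0 \<le> t" "t < l" "l - e \<le> t" using \<open>0 < e\<close> that(2) by (auto simp: t_def)
      have "(\<chi> j. a $ j + t) \<in> cube a l" using t by (simp add: cube_def)
      then have "(\<chi> j. a $ j + t) \<in> cube b r" using that(1) by blast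
      then have "a $ i + t < b $ i + r" by (simp add: cube_def)
      then show "a $ i + l \<le> b $ i + r + e" using t by linarith
    qed
  qed
  have "b $ i \<le> a $ i" "a $ i + l \<le> b $ i + r" "a $ i \<le> b $ i" "b $ i + r \<le> a $ i + l" for i
    using *[of a l b r i] *[of b r a l i] eq l r by auto
  then have "a $ i = b $ i \<and> l = r" for i by (smt (verit))
  then show ?thesis by (simp add: vec_eq_iff)
qed

lemma standard_cube_nested:
  fixes m n :: "'n::finite \<Rightarrow> int"
  assumes "k \<le> l" and x: "x \<in> standard_cube k m" "x \<in> standard_cube l n"
  shows "standard_cube k m \<subseteq> standard_cube l n"
proof
  fix y assume y: "y \<in> standard_cube k m"
  define N :: int where "N = 2 ^ nat (l - k)"
  have N: "N > 0" by (simp add: N_def)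
  have "(2::real) powi l = 2 powi (k + (l - k))" by simp
  also have "\<dots> = 2 powi k * 2 powi (l - k)" by (rule power_int_add) simp
  also have "(2::real) powi (l - k) = of_int N"
    using assms(1) by (simp add: N_def power_int_def)
  finally have e: "(2::real) powi l = 2 powi k * of_int N" .
  have fl: "\<lfloor>z / 2 powi l\<rfloor> = \<lfloor>z / 2 powi k\<rfloor> div N" for z :: real
  proof -
    have "z / 2 powi l = z / 2 powi k / of_int N" by (simp add: e)
    also have "\<lfloor>\<dots>\<rfloor> = \<lfloor>z / 2 powi k\<rfloor> div N"
      using N by (intro floor_divide_real_eq_div) simp
    finally show ?thesis .
  qed
  show "y \<in> standard_cube l n" using x y by (simp add: in_standard_cube fl)
qed

lemma dyadic_grid_standard:
  "dyadic_grid {standard_cube k m | (k::int) (m :: 'n::finite \<Rightarrow> int). True}"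
    (is "dyadic_grid ?D")
proof -
  have ne: "standard_cube k m \<noteq> {}" for k and m :: "'n \<Rightarrow> int"
  proof -
    have "(\<chi> i. 2 powi k * of_int (m i)) \<in> standard_cube k m" by (simp add: in_standard_cube)
    then show ?thesis by blast
  qed
  have gen: "{Q \<in> ?D. \<exists>a. Q = cube a (2 powi k)} = range (standard_cube k)" for k :: int
  proof (intro equalityI subsetI)
    fix Q assume "Q \<in> {Q \<in> ?D. \<exists>a. Q = cube a (2 powi k)}"
    then obtain j m a where Q: "Q = standard_cube j m" "Q = cube a (2 powi k)" by blast
    then have "(2::real) powi j = 2 powi k"
      unfolding standard_cube_def using cube_side_unique by (metis zero_less_power_int zero_less_numeral)
    then have "j = k"
      using power_int_strict_increasing[of j k "2::real"] power_int_strict_increasing[of k j "2::real"]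
      by (cases j k rule: linorder_cases) auto
    then show "Q \<in> range (standard_cube k)" using Q by blast
  qed (auto simp: standard_cube_def)
  have part: "partition_on UNIV (range (standard_cube k :: ('n \<Rightarrow> int) \<Rightarrow> _))" for k
  proof (rule partition_onI)
    show "\<Union> (range (standard_cube k :: ('n \<Rightarrow> int) \<Rightarrow> _)) = UNIV"
      by (auto simp: in_standard_cube)
    show "disjnt Q R" if "Q \<in> range (standard_cube k)" "R \<in> range (standard_cube k)" "Q \<noteq> R"
      for Q R :: "(real ^ 'n) set"
      using that by (auto simp: disjnt_iff in_standard_cube)
  qed (use ne in auto)
  have nest: "Q \<inter> R \<in> {Q, R, {}}" if QR: "Q \<in> ?D" "R \<in> ?D" for Q R
  proof -
    obtain k m l n where eq: "Q = standard_cube k m" "R = standard_cube l n" using QR by blast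
    show ?thesis
    proof (cases "Q \<inter> R = {}")
      case False
      then obtain x where x: "x \<in> Q" "x \<in> R" by blast
      have "Q \<subseteq> R \<or> R \<subseteq> Q"
        using standard_cube_nested[of k l x m n] standard_cube_nested[of l k x n m] x eq
        by (cases "k \<le> l") auto
      then show ?thesis by auto
    qed simp
  qed
  show ?thesis
    unfolding dyadic_grid_def gen using part nest by (auto simp: standard_cube_def)
qed

end

theory Submission
  imports Defs
begin

text \<open>Test the operator on \<open>f = w\<^sup>-\<^sup>p\<^sup>' 1\<^sub>A\<close> with \<open>A \<subseteq> Q \<in> \<S>\<close>, keeping only the summand of \<open>Q\<close>:
  since \<open>p (p' - 1) = p'\<close>, both the average of \<open>f\<close> over \<open>Q\<close> and the \<open>p\<close>-th power of the norm of
  \<open>f\<close> are expressed by the integral of \<open>w\<^sup>-\<^sup>p\<^sup>'\<close> over \<open>A\<close>. Because this integral over the whole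
  of \<open>Q\<close> may be infinite, \<open>A\<close> is the part of \<open>Q\<close> where \<open>w\<^sup>-\<^sup>p\<^sup>' \<le> n\<close>, and then \<open>n \<rightarrow> \<infinity>\<close>.\<close>

section \<open>Powers of extended nonnegative reals\<close>

lemma powr_ennreal_top [simp]: "\<infinity> powr\<^sub>e r = \<infinity>" "top powr\<^sub>e r = top"
  by (simp_all add: powr_ennreal_def)

lemma powr_ennreal_ennreal [simp]: "0 \<le> x \<Longrightarrow> ennreal x powr\<^sub>e r = ennreal (x powr r)"
  by (simp add: powr_ennreal_def)

lemma powr_ennreal_0 [simp]: "0 powr\<^sub>e r = 0"
  by (simp add: powr_ennreal_def)

lemma powr_ennreal_mono:
  assumes "x \<le> y" "0 \<le> r"
  shows "x powr\<^sub>e r \<le> y powr\<^sub>e r"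
proof (cases y)
  case (real b)
  then obtain a where "x = ennreal a" "0 \<le> a" "a \<le> b"
    using assms by (cases x) (auto simp: top_unique)
  with real assms show ?thesis by (auto intro!: ennreal_leI powr_mono2)
qed simp

lemma powr_ennreal_powr_inverse [simp]:
  assumes "0 < r"
  shows "(x powr\<^sub>e r) powr\<^sub>e (1 / r) = x" "(x powr\<^sub>e (1 / r)) powr\<^sub>e r = x"
  using assms by (cases x; simp add: powr_powr)+

text \<open>For positive exponents the powers \<open>r\<close> and \<open>1 / r\<close> are monotone
  and mutually inverse on the whole of [0, \<infinity>], so an exponent can change sides with no
  case split at \<infinity>.\<close>

lemma powr_ennreal_le_iff:
  assumes "0 < r"
  shows "x powr\<^sub>e r \<le> y \<longleftrightarrow> x \<le> y powr\<^sub>e (1 / r)"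
  using powr_ennreal_mono[of "x powr\<^sub>e r" y "1 / r"] powr_ennreal_mono[of x "y powr\<^sub>e (1 / r)" r]
    assms by auto

text \<open>Both bounds come from monotonicity and the equivalence just proved, so infinite and
  empty suprema are covered. This carries the truncated estimates to the limit.\<close>

lemma powr_ennreal_SUP:
  assumes "0 < r"
  shows "(SUP i\<in>I. f i) powr\<^sub>e r = (SUP i\<in>I. f i powr\<^sub>e r)"
proof (rule antisym)
  show "(SUP i\<in>I. f i) powr\<^sub>e r \<le> (SUP i\<in>I. f i powr\<^sub>e r)"
    unfolding powr_ennreal_le_iff[OF assms]
    by (intro SUP_least) (auto simp: powr_ennreal_le_iff[OF assms, symmetric] intro: SUP_upper)
  show "(SUP i\<in>I. f i powr\<^sub>e r) \<le> (SUP i\<in>I. f i) powr\<^sub>e r"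
    using assms by (intro SUP_least powr_ennreal_mono SUP_upper) auto
qed

lemma borel_measurable_powr_ennreal [measurable]:
  assumes [measurable]: "f \<in> borel_measurable M"
  shows "(\<lambda>x. f x powr\<^sub>e r) \<in> borel_measurable M"
  unfolding powr_ennreal_def by measurable

section \<open>Cubes, weights and the weak norm\<close>

lemma sets_lebesgue_cube: "cube a l \<in> sets (lebesgue :: (real ^ 'n::finite) measure)"
proof -
  have "cube a l = (\<Inter>i. {x. a $ i \<le> x $ i} \<inter> {x. x $ i < a $ i + l})"
    by (auto simp: cube_def)
  also have "\<dots> \<in> sets borel"
    by (intro sets.finite_INT sets.Int borel_closed borel_open
        closed_Collect_le open_Collect_less continuous_intros) auto
  finally show ?thesis by (intro sets_completionI_sets) simp
qed

lemma box_subset_cube: "box a (\<chi> i. a $ i + l) \<subseteq> cube a l"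
  by (auto simp: cube_def mem_box_cart less_imp_le)

lemma box_cube_nonempty: "0 < l \<Longrightarrow> box a (\<chi> i. a $ i + l) \<noteq> {}" for a :: "real ^ 'n::finite"
  by (auto simp: interval_ne_empty_cart)

text \<open>The cube lies in a bounded closed box and contains a nonempty open one. Positivity and
  finiteness of the volume suffice; its exact value never enters.\<close>

lemma emeasure_cube:
  assumes "0 < l"
  obtains v where "0 < v" "emeasure lebesgue (cube a l) = ennreal v"
proof -
  let ?Q = "cube a l"
  have "?Q \<subseteq> cbox a (\<chi> i. a $ i + l)" by (auto simp: cube_def mem_box_cart less_imp_le)
  then have "bounded ?Q" using bounded_cbox bounded_subset by blast
  then have fm: "?Q \<in> lmeasurable" using sets_lebesgue_cube bounded_set_imp_lmeasurable by blast
  have "\<not> negligible ?Q"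
    using negligible_subset[OF _ box_subset_cube] open_not_negligible[OF open_box]
      box_cube_nonempty[OF assms] by blast
  then have "measure lebesgue ?Q \<noteq> 0" using fm negligible_iff_measure0 by blast
  then show ?thesis
    using that[of "measure lebesgue ?Q"] emeasure_eq_measure2[OF fm]
    by (simp add: zero_less_measure_iff)
qed

text \<open>Each cube contains a nonempty open box, hence a point of a fixed countable dense set,
  and for a given side length a point lies in at most one cube. Countability makes the sparse
  operator measurable.\<close>

lemma countable_dyadic_grid:
  assumes "dyadic_grid (\<D> :: (real ^ 'n::finite) set set)"
  shows "countable \<D>"
proof -
  obtain X :: "(real ^ 'n) set" where X: "countable X" and
    dense: "\<And>U. open U \<Longrightarrow> U \<noteq> {} \<Longrightarrow> \<exists>x\<in>X. x \<in> U"
    using countable_dense_setE by blast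
  define G where "G k = {Q \<in> \<D>. \<exists>a. Q = cube a (2 powi k)}" for k :: int
  have part: "partition_on UNIV (G k)" for k
    using assms by (auto simp: dyadic_grid_def G_def)
  have "countable {Q \<in> G k. x \<in> Q}" for k x
  proof (cases "{Q \<in> G k. x \<in> Q} = {}")
    case False
    then obtain R where R: "R \<in> G k" "x \<in> R" by blast
    then have "{Q \<in> G k. x \<in> Q} \<subseteq> {R}"
      using partition_onD2[OF part[of k]] by (auto simp: disjoint_def)
    then show ?thesis by (rule countable_subset) simp
  qed (simp only: countable_empty)
  then have "countable (\<Union>k. \<Union>x\<in>X. {Q \<in> G k. x \<in> Q})"
    using X by (intro countable_UN) auto
  moreover have "\<D> \<subseteq> (\<Union>k. \<Union>x\<in>X. {Q \<in> G k. x \<in> Q})"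
  proof
    fix Q assume Q: "Q \<in> \<D>"
    then obtain a k where k: "Q = cube a (2 powi k)" using assms by (auto simp: dyadic_grid_def)
    have "\<exists>x\<in>X. x \<in> box a (\<chi> i. a $ i + 2 powi k)"
      by (intro dense box_cube_nonempty open_box) simp
    then show "Q \<in> (\<Union>k. \<Union>x\<in>X. {Q \<in> G k. x \<in> Q})"
      using Q k box_subset_cube[of a "2 powi k"] unfolding G_def by blast
  qed
  ultimately show ?thesis by (rule countable_subset[rotated])
qed

text \<open>Local integrability makes the cut-offs to balls of radius \<open>n\<close> measurable,
  and at every point these are eventually equal to \<open>w\<close>.\<close>

lemma borel_measurable_weight:
  fixes w :: "real ^ 'n::finite \<Rightarrow> real"
  assumes "weight w"
  shows "w \<in> borel_measurable lebesgue"
proof (rule borel_measurable_LIMSEQ_real)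
  fix x :: "real ^ 'n"
  obtain N where N: "norm x \<le> real N" using real_arch_simple by blast
  have "\<forall>\<^sub>F n in sequentially. indicator (cball 0 (real n)) x *\<^sub>R w x = w x"
    using eventually_ge_at_top[of N] by eventually_elim (use N in auto)
  then show "(\<lambda>n. indicator (cball 0 (real n)) x *\<^sub>R w x) \<longlonglongrightarrow> w x"
    by (rule tendsto_eventually)
next
  fix n
  have "w absolutely_integrable_on cball 0 (real n)"
    using assms by (simp add: weight_def)
  then show "(\<lambda>x. indicator (cball 0 (real n)) x *\<^sub>R w x) \<in> borel_measurable lebesgue"
    by (simp add: set_integrable_def borel_measurable_integrable)
qed

text \<open>A nonnegative sum is the supremum of its finite partial sums, and a countable index set
  has only countably many finite subsets.\<close>

lemma borel_measurable_infsum_ennreal: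
  fixes f :: "'i \<Rightarrow> 'a \<Rightarrow> ennreal"
  assumes "countable I" and f [measurable]: "\<And>i. i \<in> I \<Longrightarrow> f i \<in> borel_measurable M"
  shows "(\<lambda>x. \<Sum>\<^sub>\<infinity>i\<in>I. f i x) \<in> borel_measurable M"
proof -
  have "(\<lambda>x. \<Sum>\<^sub>\<infinity>i\<in>I. f i x) = (\<lambda>x. SUP F\<in>{F. finite F \<and> F \<subseteq> I}. \<Sum>i\<in>F. f i x)"
    by (simp add: nonneg_infsum_complete)
  moreover have "countable {F. finite F \<and> F \<subseteq> I}"
    using assms(1) by (simp add: countable_Collect_finite_subset)
  ultimately show ?thesis by (auto intro!: borel_measurable_SUP borel_measurable_sum)
qed

lemma borel_measurable_sparse_op:
  assumes "countable \<S>" "\<And>Q. Q \<in> \<S> \<Longrightarrow> Q \<in> sets lebesgue"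
  shows "sparse_op \<alpha> \<nu> \<S> f \<in> borel_measurable lebesgue"
  unfolding sparse_op_def
  by (intro borel_measurable_powr_ennreal borel_measurable_infsum_ennreal
      borel_measurable_times_ennreal borel_measurable_const borel_measurable_indicator assms)

lemma frac_avg_le_sparse_op:
  assumes "0 < \<nu>" "Q \<in> \<S>" "x \<in> Q"
  shows "frac_avg \<alpha> Q f \<le> sparse_op \<alpha> \<nu> \<S> f x"
proof -
  let ?g = "\<lambda>Q. frac_avg \<alpha> Q f powr\<^sub>e \<nu> * indicator Q x"
  have "(\<Sum>\<^sub>\<infinity>R\<in>{Q}. ?g R) \<le> (\<Sum>\<^sub>\<infinity>R\<in>\<S>. ?g R)"
    using assms by (intro infsum_mono_neutral nonneg_summable_on_complete) auto
  then have "frac_avg \<alpha> Q f powr\<^sub>e \<nu> \<le> (\<Sum>\<^sub>\<infinity>R\<in>\<S>. ?g R)"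
    using assms by simp
  then show ?thesis
    unfolding sparse_op_def using assms(1) by (simp add: powr_ennreal_le_iff)
qed

text \<open>The weak norm uses strict superlevel sets at positive real levels, so a lower bound
  \<open>F\<close> is reached only through levels below it. For \<open>F = 0\<close> the index set
  is empty and the supremum is 0.\<close>

lemma ennreal_eq_SUP_less:
  fixes F :: ennreal
  shows "F = (SUP l\<in>{l. 0 < l \<and> ennreal l < F}. ennreal l)" (is "_ = ?S")
proof (rule antisym)
  show "F \<le> ?S"
  proof (rule ccontr)
    assume "\<not> F \<le> ?S"
    then have "?S < F" by (simp only: not_le)
    from dense[OF this] obtain y where y: "?S < y" "y < F" by (elim exE conjE)
    then obtain l where l: "y = ennreal l" "0 \<le> l" by (cases y) auto
    then have "0 < l" using y(1) by (cases "l = 0") auto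
    then have "y \<le> ?S" unfolding l(1) using y l by (intro SUP_upper) auto
    then show False using y by simp
  qed
qed (auto intro!: SUP_least)

text \<open>For every level \<open>l\<close> below \<open>F\<close> the set \<open>A\<close> lies in
  the superlevel set of \<open>g\<close>; the supremum over these levels recovers \<open>F\<close>,
  even when it is infinite.\<close>

lemma weak_Lq_norm_ge:
  assumes g: "g \<in> borel_measurable M" and A: "A \<in> sets M" and le: "\<And>x. x \<in> A \<Longrightarrow> F \<le> g x"
    and q: "0 < q"
  shows "F * emeasure M A powr\<^sub>e (1 / q) \<le> weak_Lq_norm q M g"
proof -
  have "ennreal l * emeasure M A powr\<^sub>e (1 / q) \<le> weak_Lq_norm q M g" if l: "0 < l" "ennreal l < F" for l
  proof -
    let ?B = "{x \<in> space M. g x > ennreal l}"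
    have "?B \<in> sets M" using g by measurable
    moreover have "A \<subseteq> ?B" using le l sets.sets_into_space[OF A] by (auto intro: less_le_trans)
    ultimately have "emeasure M A powr\<^sub>e (1 / q) \<le> emeasure M ?B powr\<^sub>e (1 / q)"
      using q by (intro powr_ennreal_mono emeasure_mono) auto
    then have "ennreal l * emeasure M A powr\<^sub>e (1 / q) \<le> ennreal l * emeasure M ?B powr\<^sub>e (1 / q)"
      by (rule mult_left_mono) simp
    also have "\<dots> \<le> weak_Lq_norm q M g"
      unfolding weak_Lq_norm_def using l by (intro SUP_upper) auto
    finally show ?thesis .
  qed
  then show ?thesis
    by (subst ennreal_eq_SUP_less[of F], subst SUP_mult_right_ennreal)
      (auto intro!: SUP_least)
qed

section \<open>The lower bound\<close>

text \<open>With b = 1/p' the relation between the exponents reads 1 - \<alpha>/d = 1/q + b. So the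
  power of \<open>v\<close> splits into one factor for \<open>W\<close> and one for
  \<open>s\<close>, dividing by s^(1/p) = s^(1-b) leaves s^b, and the \<open>q\<close>-th power
  gives the claim.\<close>

lemma sparse_test_real:
  fixes d :: real
  assumes "1 < p" "0 < q" "1 / q + \<alpha> / d = 1 / p" "0 < s" "0 < v" "0 \<le> W"
    and le: "s / v powr (1 - \<alpha> / d) * W powr (1 / q) \<le> C * s powr (1 / p)"
  shows "W / v * (s / v) powr (q / conj_exp p) \<le> C powr q"
proof -
  define b where "b = 1 / conj_exp p"
  have b: "1 / p = 1 - b" "1 - \<alpha> / d = 1 / q + b"
    using conj_exp[OF assms(1)] assms(3) by (auto simp: b_def)
  have s: "s / s powr (1 - b) = s powr b"
    using assms(4) powr_diff[of s 1 "1 - b"] by simp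
  have "W powr (1 / q) / v powr (1 / q) * (s powr b / v powr b)
      = s / v powr (1 - \<alpha> / d) * W powr (1 / q) / s powr (1 / p)"
    unfolding b s[symmetric] using assms by (simp add: powr_add mult_ac)
  also have "\<dots> \<le> C" using le assms(4) by (subst pos_divide_le_eq) auto
  finally have "(W powr (1 / q) / v powr (1 / q) * (s powr b / v powr b)) powr q \<le> C powr q"
    using assms by (intro powr_mono2) auto
  also have "(W powr (1 / q) / v powr (1 / q) * (s powr b / v powr b)) powr q
      = W / v * (s / v) powr (q * b)"
    using assms by (simp add: powr_mult powr_divide powr_powr mult.commute)
  finally show ?thesis by (simp add: b_def)
qed

text \<open>Reduction to finite values: for \<open>s = 0\<close> the left side vanishes, even if
  \<open>W\<close> is infinite, because 0 times \<infinity> is 0; for \<open>C = \<infinity>\<close>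
  the right side is infinite.\<close>

lemma sparse_test_ennreal:
  fixes W C :: ennreal and d :: real
  assumes "1 < p" "0 < q" "1 / q + \<alpha> / d = 1 / p" "0 \<le> s" "0 < v"
    and le: "ennreal s / ennreal v powr\<^sub>e (1 - \<alpha> / d) * W powr\<^sub>e (1 / q)
      \<le> C * ennreal s powr\<^sub>e (1 / p)"
  shows "W / ennreal v * (ennreal s / ennreal v) powr\<^sub>e (q / conj_exp p) \<le> C powr\<^sub>e q"
proof (cases "s = 0 \<or> C = \<infinity>")
  case True
  then show ?thesis by auto
next
  case False
  then have s: "0 < s" and "C \<noteq> \<infinity>" using assms by auto
  then obtain c where c: "C = ennreal c" "0 \<le> c" by (cases C) auto
  have t: "ennreal s / ennreal v powr\<^sub>e (1 - \<alpha> / d) = ennreal (s / v powr (1 - \<alpha> / d))"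
    using s assms by (simp add: divide_ennreal)
  \<comment> \<open>An infinite \<open>W\<close> would make the left side of \<open>le\<close>
    infinite, since its other factor is positive, while the right side is finite.\<close>
  have "W \<noteq> \<infinity>"
  proof
    assume "W = \<infinity>"
    then have "ennreal (s / v powr (1 - \<alpha> / d)) * top \<le> ennreal (c * s powr (1 / p))"
      using le s c unfolding t by (simp add: ennreal_mult)
    then show False using s assms(5) by (simp add: ennreal_mult_top top_unique)
  qed
  then obtain x where x: "W = ennreal x" "0 \<le> x" by (cases W) auto
  have "s / v powr (1 - \<alpha> / d) * x powr (1 / q) \<le> c * s powr (1 / p)"
    using le s c x assms unfolding t by (simp add: ennreal_mult[symmetric])
  from sparse_test_real[OF assms(1-3) s assms(5) x(2) this] show ?thesis
    using s c x assms by (simp add: divide_ennreal ennreal_mult[symmetric])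
qed

text \<open>Finiteness of the integral \<open>s\<close> over \<open>A\<close> puts the test function
  into \<open>Lp_space\<close>, so that \<open>C\<close> applies to it. The measure of
  \<open>Q\<close> for w^q may still be infinite.\<close>

lemma sparse_test:
  fixes w :: "real ^ 'n::finite \<Rightarrow> real"
  assumes "0 < \<nu>" "1 < p" "0 < q" "1 / q + \<alpha> / real CARD('n) = 1 / p"
    and \<S>: "countable \<S>" "\<And>Q. Q \<in> \<S> \<Longrightarrow> Q \<in> sets lebesgue" and Q: "Q \<in> \<S>"
    and v: "emeasure lebesgue Q = ennreal v" "0 < v"
    and w: "w \<in> borel_measurable lebesgue" "\<And>x. 0 < w x"
    and A: "A \<in> sets lebesgue" "A \<subseteq> Q"
    and s: "emeasure (weighted w (- conj_exp p)) A = ennreal s" "0 \<le> s"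
    and C: "\<forall>f\<in>Lp_space p (weighted w p). (\<forall>x. 0 \<le> f x) \<longrightarrow>
      weak_Lq_norm q (weighted w q) (sparse_op \<alpha> \<nu> \<S> f) \<le> C * Lp_norm p (weighted w p) f"
  shows "emeasure (weighted w q) Q / ennreal v * (ennreal s / ennreal v) powr\<^sub>e (q / conj_exp p)
    \<le> C powr\<^sub>e q"
proof -
  note [measurable] = w(1) A(1)
  define f where "f x = w x powr (- conj_exp p) * indicator A x" for x
  have f [measurable]: "f \<in> borel_measurable lebesgue" unfolding f_def by measurable
  have f0: "0 \<le> f x" for x by (simp add: f_def)
  have s': "(\<integral>\<^sup>+x. ennreal (w x powr (- conj_exp p)) * indicator A x \<partial>lebesgue) = ennreal s"
    using s(1) A(1) unfolding weighted_def by (subst (asm) emeasure_density) auto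
  \<comment> \<open>Hence multiplying f^p by the density w^p gives back w^(-p') on \<open>A\<close>,
    and norm and average involve the same integral \<open>s\<close>.\<close>
  have exponents: "- (conj_exp p * p) + p = - conj_exp p"
    using assms(2) by (simp add: conj_exp_def field_simps)
  have "ennreal (w x powr p) * ennreal (\<bar>f x\<bar> powr p)
      = ennreal (w x powr (- conj_exp p)) * indicator A x" for x
    using w(2)[of x] exponents
    by (auto simp: f_def indicator_def powr_powr ennreal_mult[symmetric] powr_add[symmetric] add.commute)
  then have N: "Lp_norm p (weighted w p) f = ennreal s powr\<^sub>e (1 / p)"
    unfolding Lp_norm_def weighted_def using s' by (subst nn_integral_density) auto
  have "f \<in> Lp_space p (weighted w p)"
    using N s(2) f by (simp add: Lp_space_def weighted_def ennreal_less_top)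
  with C f0 have weak: "weak_Lq_norm q (weighted w q) (sparse_op \<alpha> \<nu> \<S> f) \<le> C * ennreal s powr\<^sub>e (1 / p)"
    unfolding N[symmetric] by blast
  have "ennreal (f x) * indicator Q x = ennreal (w x powr (- conj_exp p)) * indicator A x" for x
    using A(2) by (auto simp: f_def indicator_def)
  then have F: "frac_avg \<alpha> Q f = ennreal s / ennreal v powr\<^sub>e (1 - \<alpha> / real CARD('n))"
    using s' v by (simp add: frac_avg_def)
  \<comment> \<open>Although \<open>f\<close> lives on \<open>A\<close>, the operator is at least
    the average on all of \<open>Q\<close>, so the full w^q-measure of \<open>Q\<close>
    appears.\<close>
  have "frac_avg \<alpha> Q f * emeasure (weighted w q) Q powr\<^sub>e (1 / q)
      \<le> weak_Lq_norm q (weighted w q) (sparse_op \<alpha> \<nu> \<S> f)"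
    using borel_measurable_sparse_op[OF \<S>] \<S>(2)[OF Q] assms(3)
    by (intro weak_Lq_norm_ge frac_avg_le_sparse_op[OF assms(1) Q]) (auto simp: weighted_def)
  with weak have "ennreal s / ennreal v powr\<^sub>e (1 - \<alpha> / real CARD('n))
      * emeasure (weighted w q) Q powr\<^sub>e (1 / q) \<le> C * ennreal s powr\<^sub>e (1 / p)"
    unfolding F by (rule order_trans[rotated])
  from sparse_test_ennreal[OF assms(2-4) s(2) v(2) this] show ?thesis .
qed

theorem theorem4p11:
  fixes \<nu> \<alpha> p q \<gamma> :: real
    and \<D> \<S> :: "(real ^ 'n::finite) set set"
    and w :: "real ^ 'n \<Rightarrow> real"
  assumes "0 < \<nu>"
    and "0 \<le> \<alpha>" and "\<alpha> < real CARD('n)"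
    and "1 < p" and "p \<le> q"
    and "1 / q + \<alpha> / real CARD('n) = 1 / p"
    and "dyadic_grid \<D>" and "\<S> \<subseteq> \<D>" and "sparse_collection \<gamma> \<S>"
    and "weight w"
  shows "sparse_op_norm \<alpha> \<nu> \<S> p q w \<ge> Apq_char \<S> p q w powr\<^sub>e (1 / q)"
  unfolding sparse_op_norm_def
proof (rule Inf_greatest, clarify)
  fix C
  assume C: "\<forall>f\<in>Lp_space p (weighted w p). (\<forall>x. 0 \<le> f x) \<longrightarrow>
      weak_Lq_norm q (weighted w q) (sparse_op \<alpha> \<nu> \<S> f) \<le> C * Lp_norm p (weighted w p) f"
  have q: "0 < q" using assms by simp
  have c: "0 < q / conj_exp p" using assms(4) q by (simp add: conj_exp_def)
  have w [measurable]: "w \<in> borel_measurable lebesgue" and w0: "\<And>x. 0 < w x"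
    using assms(10) borel_measurable_weight by (auto simp: weight_def)
  have cubes: "\<exists>a k. Q = cube a (2 powi k)" if "Q \<in> \<S>" for Q
    using that assms(7,8) by (auto simp: dyadic_grid_def)
  have ctb: "countable \<S>"
    using countable_dyadic_grid[OF assms(7)] assms(8) countable_subset by blast
  have meas: "Q \<in> sets lebesgue" if "Q \<in> \<S>" for Q
    using cubes[OF that] sets_lebesgue_cube by auto
  have "avg Q (\<lambda>x. w x powr q) * avg Q (\<lambda>x. w x powr (- conj_exp p)) powr\<^sub>e (q / conj_exp p)
      \<le> C powr\<^sub>e q" if Q: "Q \<in> \<S>" for Q
  proof -
    note [measurable] = meas[OF Q]
    obtain a k where "Q = cube a (2 powi k)" using cubes[OF Q] by blast
    then obtain v where v: "emeasure lebesgue Q = ennreal v" "0 < v"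
      using emeasure_cube[of "2 powi k" a] by auto
    have avg_eq: "avg Q (\<lambda>x. w x powr r) = emeasure (weighted w r) Q / ennreal v" for r
      unfolding avg_def v weighted_def by (subst emeasure_density) auto
    define M where "M = weighted w (- conj_exp p)"
    \<comment> \<open>Truncation at height \<open>n\<close> bounds the integral of w^(-p') over
      \<open>A n\<close> by \<open>n\<close> times the volume of \<open>Q\<close>.\<close>
    define A where "A n = {x \<in> Q. w x powr (- conj_exp p) \<le> real n}" for n :: nat
    have A [measurable]: "A n \<in> sets lebesgue" for n
    proof -
      have "A n = Q \<inter> {x \<in> space lebesgue. w x powr (- conj_exp p) \<le> real n}"
        by (auto simp: A_def)
      then show ?thesis by simp
    qed
    have AM: "A n \<in> sets M" for n by (simp add: M_def weighted_def)
    have fin: "emeasure M (A n) < \<infinity>" for n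
    proof -
      have "emeasure M (A n) = (\<integral>\<^sup>+x. ennreal (w x powr (- conj_exp p)) * indicator (A n) x \<partial>lebesgue)"
        unfolding M_def weighted_def by (subst emeasure_density) auto
      also have "\<dots> \<le> (\<integral>\<^sup>+x. ennreal (real n) * indicator Q x \<partial>lebesgue)"
        by (intro nn_integral_mono) (auto simp: A_def indicator_def intro!: ennreal_leI)
      also have "\<dots> = ennreal (real n) * ennreal v" by (simp add: nn_integral_cmult_indicator v)
      also have "\<dots> < \<infinity>" by (simp add: ennreal_mult_less_top)
      finally show ?thesis .
    qed
    have "incseq A" by (auto simp: A_def incseq_def intro: order_trans)
    then have "(SUP n. emeasure M (A n)) = emeasure M (\<Union>n. A n)"
      using AM by (intro SUP_emeasure_incseq) auto
    \<comment> \<open>The function w^(-p') is real-valued, so each point of \<open>Q\<close> passes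
      the truncation for large \<open>n\<close>.\<close>
    also have "(\<Union>n. A n) = Q" using real_arch_simple by (auto simp: A_def)
    finally have sup: "emeasure M Q = (SUP n. emeasure M (A n))" by simp
    let ?W = "emeasure (weighted w q) Q / ennreal v"
    \<comment> \<open>Division by \<open>v\<close>, the positive power and the factor
      \<open>?W\<close>, possibly infinite, all commute with the supremum.\<close>
    have "?W * (emeasure M Q / ennreal v) powr\<^sub>e (q / conj_exp p)
        = (SUP n. ?W * (emeasure M (A n) / ennreal v) powr\<^sub>e (q / conj_exp p))"
      unfolding sup by (simp add: SUP_divide_ennreal powr_ennreal_SUP[OF c] SUP_mult_left_ennreal)
    also have "\<dots> \<le> C powr\<^sub>e q"
    proof (rule SUP_least)
      fix n
      obtain s where s: "emeasure M (A n) = ennreal s" "0 \<le> s"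
        using fin[of n] by (cases "emeasure M (A n)") auto
      show "?W * (emeasure M (A n) / ennreal v) powr\<^sub>e (q / conj_exp p) \<le> C powr\<^sub>e q"
        unfolding s(1)
        by (rule sparse_test[OF assms(1,4) q assms(6) ctb meas Q v w w0 A _ s[unfolded M_def] C])
          (auto simp: A_def)
    qed
    finally show ?thesis unfolding avg_eq M_def .
  qed
  then have "Apq_char \<S> p q w \<le> C powr\<^sub>e q"
    unfolding Apq_char_def by (intro SUP_least)
  then show "Apq_char \<S> p q w powr\<^sub>e (1 / q) \<le> C"
    using q by (simp add: powr_ennreal_le_iff)
qed

end
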